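(* Let $a<b$ be real numbers, let $f\in C^2([a,b])$ be real-valued, and let $m_2,M_2\in\mathbb{R}$ satisfy $m_2\le f''(x)\le M_2$ for all $x\in[a,b]$. Then for all $x\in[a,b]$, $$\left|f(x)-\left[\Pi_{[a,b]}(f)(x)-\left(\frac{f'(b)-f'(a)}{2(b-a)}\right)(b-x)(x-a)\right]\right|\le\frac{(b-a)^2}{32}(M_2-m_2).$$
   Context: $\Pi_{[a,b]}(f)$ denotes the $P_1$-Lagrange interpolation polynomial of $f$ on $[a,b]$, i.e. the polynomial of degree at most one given by $$\Pi_{[a,b]}(f)(x)=\frac{x-b}{a-b}\,f(a)+\frac{x-a}{b-a}\,f(b).$$ *)

theory Defs
  imports "HOL-Analysis.Analysis"
begin

definition P1_interp :: "real \<Rightarrow> real \<Rightarrow> (real \<Rightarrow> real) \<Rightarrow> real \<Rightarrow> real" where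
  "P1_interp a b f x = (x - b) / (a - b) * f a + (x - a) / (b - a) * f b"

(* At the endpoints the derivatives are one-sided.  For a < b they are unique on {a..b}, so f' and
   f'' are determined there by f; continuity of f and f' is implied by their differentiability. *)
definition C2_on_Icc ::
  "real \<Rightarrow> real \<Rightarrow> (real \<Rightarrow> real) \<Rightarrow> (real \<Rightarrow> real) \<Rightarrow> (real \<Rightarrow> real) \<Rightarrow> bool" where
  "C2_on_Icc a b f f' f'' \<longleftrightarrow>
     (\<forall>x\<in>{a..b}. (f has_real_derivative f' x) (at x within {a..b})) \<and>
     (\<forall>x\<in>{a..b}. (f' has_real_derivative f'' x) (at x within {a..b})) \<and>
     continuous_on {a..b} f''"

end

theory Submission
  imports Defs
begin

text \<open>
  Split the interval at the evaluation point \<open>x\<close> and apply the trapezoidal rule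
  \<open>(v - u) (f' u + f' v) / 2\<close> for the increment \<open>f v - f u\<close> on each of \<open>[a, x]\<close> and \<open>[x, b]\<close>.
  Weight the first increment by \<open>(b - x) / (b - a)\<close> and the second by \<open>(x - a) / (b - a)\<close>, the
  barycentric coordinates of \<open>x\<close>: in the difference the terms with \<open>f' x\<close> cancel, the values of
  \<open>f\<close> combine to \<open>f x\<close> minus the linear interpolant, and \<open>f' a\<close>, \<open>f' b\<close> produce exactly the
  correction term. The quantity to bound is therefore a weighted difference of two trapezoidal
  errors.

  Each trapezoidal error is at most \<open>(M - m) (v - u)\<^sup>2 / 8\<close> (lemma \<open>trapezoid_error\<close>). This
  constant depends only on the oscillation of \<open>f''\<close>, as the error compares Taylor remainders at the
  midpoint taken from both ends: they both lie between \<open>m (v - u)\<^sup>2 / 8\<close> and \<open>M (v - u)\<^sup>2 / 8\<close>.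
  The weighted errors add up to at most \<open>(M - m) (x - a) (b - x) / 8\<close>, and
  \<open>(x - a) (b - x) \<le> (b - a)\<^sup>2 / 4\<close> yields the constant \<open>1 / 32\<close>.
\<close>

lemma mean_value_within:
  fixes g g' :: "real \<Rightarrow> real"
  assumes "\<And>t. t \<in> {a..b} \<Longrightarrow> (g has_real_derivative g' t) (at t within {a..b})"
    and "u \<in> {a..b}" "v \<in> {a..b}" "u \<le> v"
  obtains \<xi> where "\<xi> \<in> {u..v}" "g v - g u = g' \<xi> * (v - u)"
proof -
  have "\<exists>\<xi>\<in>{u..v}. g v - g u = (\<lambda>h. g' \<xi> * h) (v - u)"
  proof (rule mvt_very_simple[OF \<open>u \<le> v\<close>])
    fix t assume "u \<le> t" "t \<le> v"
    with assms(2,3) have "t \<in> {a..b}" "{u..v} \<subseteq> {a..b}" by auto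
    then have "(g has_real_derivative g' t) (at t within {u..v})"
      using assms(1) by (blast intro: DERIV_subset)
    then show "(g has_derivative (\<lambda>h. g' t * h)) (at t within {u..v})"
      by (simp add: has_field_derivative_def)
  qed
  then show thesis using that by auto
qed

text \<open>
  A function with nonnegative second derivative lies above its tangents. The version here includes
  tangents at the endpoints of the interval, where only one-sided derivatives are available, and
  places no order on the point of tangency \<open>u\<close> and the point \<open>v\<close>.
\<close>

lemma above_tangent_within:
  fixes g g' g'' :: "real \<Rightarrow> real"
  assumes g': "\<And>t. t \<in> {a..b} \<Longrightarrow> (g has_real_derivative g' t) (at t within {a..b})"
    and g'': "\<And>t. t \<in> {a..b} \<Longrightarrow> (g' has_real_derivative g'' t) (at t within {a..b})"
    and nonneg: "\<And>t. t \<in> {a..b} \<Longrightarrow> 0 \<le> g'' t"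
    and u: "u \<in> {a..b}" and v: "v \<in> {a..b}"
  shows "g u + g' u * (v - u) \<le> g v"
proof -
  have mono: "g' s \<le> g' t" if st: "s \<in> {a..b}" "t \<in> {a..b}" "s \<le> t" for s t
  proof -
    obtain \<xi> where \<xi>: "\<xi> \<in> {s..t}" "g' t - g' s = g'' \<xi> * (t - s)"
      by (rule mean_value_within[OF g'' st])
    have "0 \<le> g'' \<xi> * (t - s)"
      using nonneg[of \<xi>] \<xi>(1) st by auto
    with \<xi>(2) show ?thesis by simp
  qed
  show ?thesis
  proof (cases "u \<le> v")
    case True
    obtain \<xi> where \<xi>: "\<xi> \<in> {u..v}" "g v - g u = g' \<xi> * (v - u)"
      by (rule mean_value_within[OF g' u v True])
    have "g' u * (v - u) \<le> g' \<xi> * (v - u)"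
      using mono[of u \<xi>] \<xi>(1) u v by (intro mult_right_mono) auto
    with \<xi>(2) show ?thesis by simp
  next
    case False
    then have "v \<le> u" by simp
    obtain \<xi> where \<xi>: "\<xi> \<in> {v..u}" "g u - g v = g' \<xi> * (u - v)"
      by (rule mean_value_within[OF g' v u \<open>v \<le> u\<close>])
    have "g' \<xi> * (u - v) \<le> g' u * (u - v)"
      using mono[of \<xi> u] \<xi>(1) u v by (intro mult_right_mono) auto
    with \<xi>(2) show ?thesis by (simp add: algebra_simps)
  qed
qed

text \<open>
  Subtracting the parabola \<open>m t\<^sup>2 / 2\<close> from \<open>f\<close> leaves a function with nonnegative second
  derivative, so the bound on the Taylor remainder is the tangent inequality for it.
\<close>

lemma taylor_remainder_lower:
  fixes f f' f'' :: "real \<Rightarrow> real"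
  assumes f': "\<And>t. t \<in> {a..b} \<Longrightarrow> (f has_real_derivative f' t) (at t within {a..b})"
    and f'': "\<And>t. t \<in> {a..b} \<Longrightarrow> (f' has_real_derivative f'' t) (at t within {a..b})"
    and lower: "\<And>t. t \<in> {a..b} \<Longrightarrow> m \<le> f'' t"
    and u: "u \<in> {a..b}" and v: "v \<in> {a..b}"
  shows "m * (v - u)\<^sup>2 / 2 \<le> f v - f u - f' u * (v - u)"
proof -
  have "(f u - m * u\<^sup>2 / 2) + (f' u - m * u) * (v - u) \<le> f v - m * v\<^sup>2 / 2"
  proof (rule above_tangent_within[where g = "\<lambda>t. f t - m * t\<^sup>2 / 2" and g' = "\<lambda>t. f' t - m * t"
        and g'' = "\<lambda>t. f'' t - m", OF _ _ _ u v])
    fix t assume t: "t \<in> {a..b}"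
    show "((\<lambda>t. f t - m * t\<^sup>2 / 2) has_real_derivative f' t - m * t) (at t within {a..b})"
      by (auto intro!: derivative_eq_intros f'[OF t])
    show "((\<lambda>t. f' t - m * t) has_real_derivative f'' t - m) (at t within {a..b})"
      by (auto intro!: derivative_eq_intros f''[OF t])
    show "0 \<le> f'' t - m" using lower[OF t] by simp
  qed
  then show ?thesis by (simp add: power2_eq_square field_simps)
qed

lemma taylor_remainder_upper:
  fixes f f' f'' :: "real \<Rightarrow> real"
  assumes f': "\<And>t. t \<in> {a..b} \<Longrightarrow> (f has_real_derivative f' t) (at t within {a..b})"
    and f'': "\<And>t. t \<in> {a..b} \<Longrightarrow> (f' has_real_derivative f'' t) (at t within {a..b})"
    and upper: "\<And>t. t \<in> {a..b} \<Longrightarrow> f'' t \<le> M"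
    and u: "u \<in> {a..b}" and v: "v \<in> {a..b}"
  shows "f v - f u - f' u * (v - u) \<le> M * (v - u)\<^sup>2 / 2"
proof -
  have "(- M) * (v - u)\<^sup>2 / 2 \<le> - f v - (- f u) - (- f' u) * (v - u)"
    by (rule taylor_remainder_lower[where f = "\<lambda>t. - f t" and f' = "\<lambda>t. - f' t"
          and f'' = "\<lambda>t. - f'' t", OF _ _ _ u v])
      (auto intro!: DERIV_minus f' f'' simp: upper)
  then show ?thesis by simp
qed

text \<open>
  Expanding \<open>f\<close> at the midpoint \<open>c\<close> once from \<open>u\<close> and once from \<open>v\<close> and subtracting eliminates
  \<open>f c\<close>; what is left is the trapezoidal error as the difference of the two remainders, so a common
  parabolic part of \<open>f\<close> drops out and only \<open>M - m\<close> matters.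
\<close>

lemma trapezoid_error:
  fixes f f' f'' :: "real \<Rightarrow> real"
  assumes f': "\<And>t. t \<in> {a..b} \<Longrightarrow> (f has_real_derivative f' t) (at t within {a..b})"
    and f'': "\<And>t. t \<in> {a..b} \<Longrightarrow> (f' has_real_derivative f'' t) (at t within {a..b})"
    and lower: "\<And>t. t \<in> {a..b} \<Longrightarrow> m \<le> f'' t"
    and upper: "\<And>t. t \<in> {a..b} \<Longrightarrow> f'' t \<le> M"
    and u: "u \<in> {a..b}" and v: "v \<in> {a..b}"
  shows "\<bar>f v - f u - (f' u + f' v) / 2 * (v - u)\<bar> \<le> (M - m) * (v - u)\<^sup>2 / 8"
proof -
  define c where "c = (u + v) / 2"
  define R where "R w = f c - f w - f' w * (c - w)" for w
  have c: "c \<in> {a..b}" using u v by (auto simp: c_def)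
  have R: "m * (c - w)\<^sup>2 / 2 \<le> R w" "R w \<le> M * (c - w)\<^sup>2 / 2" if "w \<in> {a..b}" for w
    unfolding R_def
    using taylor_remainder_lower[OF f' f'' lower that c]
      taylor_remainder_upper[OF f' f'' upper that c] by auto
  have sq: "(c - u)\<^sup>2 = (v - u)\<^sup>2 / 4" "(c - v)\<^sup>2 = (v - u)\<^sup>2 / 4"
    by (simp_all add: c_def power2_eq_square field_simps)
  have "f v - f u - (f' u + f' v) / 2 * (v - u) = R u - R v"
    by (simp add: R_def c_def field_simps)
  moreover have "\<bar>R u - R v\<bar> \<le> (M - m) * (v - u)\<^sup>2 / 8"
    using R[OF u] R[OF v] unfolding sq by (intro abs_leI) (simp_all add: left_diff_distrib)
  ultimately show ?thesis by simp
qed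

theorem lemma3p2:
  fixes a b m2 M2 :: real and f f' f'' :: "real \<Rightarrow> real"
  assumes "a < b"
    and "C2_on_Icc a b f f' f''"
    and "\<forall>x\<in>{a..b}. m2 \<le> f'' x \<and> f'' x \<le> M2"
  shows "\<forall>x\<in>{a..b}.
    \<bar>f x - (P1_interp a b f x - ((f' b - f' a) / (2 * (b - a))) * (b - x) * (x - a))\<bar>
      \<le> (b - a)^2 / 32 * (M2 - m2)"
proof
  fix x assume x: "x \<in> {a..b}"
  have f': "(f has_real_derivative f' t) (at t within {a..b})"
    and f'': "(f' has_real_derivative f'' t) (at t within {a..b})"
    and lower: "m2 \<le> f'' t" and upper: "f'' t \<le> M2" if "t \<in> {a..b}" for t
    using assms(2,3) that by (auto simp: C2_on_Icc_def)
  define T where "T u v = f v - f u - (f' u + f' v) / 2 * (v - u)" for u v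
  define p q where "p = x - a" and "q = b - x"
  have pq: "0 \<le> p" "0 \<le> q" "0 < p + q" "b - a = p + q"
    using x \<open>a < b\<close> by (auto simp: p_def q_def)
  have a: "a \<in> {a..b}" and b: "b \<in> {a..b}" using \<open>a < b\<close> by auto
  have Tp: "\<bar>T a x\<bar> \<le> (M2 - m2) * p\<^sup>2 / 8"
    unfolding T_def p_def by (rule trapezoid_error[OF f' f'' lower upper a x])
  have Tq: "\<bar>T x b\<bar> \<le> (M2 - m2) * q\<^sup>2 / 8"
    unfolding T_def q_def by (rule trapezoid_error[OF f' f'' lower upper x b])
  let ?E = "f x - (P1_interp a b f x - ((f' b - f' a) / (2 * (b - a))) * (b - x) * (x - a))"
  have P1: "P1_interp a b f x = (q * f a + p * f b) / (p + q)"
  proof -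
    have "(x - b) / (a - b) = q / (p + q)"
      using minus_divide_divide[of "b - x" "b - a"] by (simp add: p_def q_def)
    then show ?thesis
      by (simp add: P1_interp_def pq(4) add_divide_distrib p_def[symmetric])
  qed
  have "?E * (p + q) = f x * (p + q) - (q * f a + p * f b) + (f' b - f' a) / 2 * q * p"
  proof -
    have "(y - (z / s - d / (2 * s) * q * p)) * s = y * s - z + d / 2 * q * p"
      if "0 < s" for y z d s :: real
      using that by (simp add: field_simps)
    from this[OF pq(3)] show ?thesis
      unfolding P1 pq(4) p_def[symmetric] q_def[symmetric] .
  qed
  also have "\<dots> = q * T a x - p * T x b"
    by (simp add: T_def p_def[symmetric] q_def[symmetric] field_simps)
  finally have E: "\<bar>?E\<bar> * (p + q) = \<bar>q * T a x - p * T x b\<bar>"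
    using pq(3) by (metis abs_mult abs_of_pos)
  have "\<bar>q * T a x - p * T x b\<bar> \<le> q * \<bar>T a x\<bar> + p * \<bar>T x b\<bar>"
    using abs_triangle_ineq4[of "q * T a x" "p * T x b"] pq by (simp add: abs_mult)
  also have "\<dots> \<le> q * ((M2 - m2) * p\<^sup>2 / 8) + p * ((M2 - m2) * q\<^sup>2 / 8)"
    using Tp Tq pq by (intro add_mono mult_left_mono) auto
  also have "\<dots> = ((M2 - m2) * (p * q) / 8) * (p + q)"
    by (simp add: power2_eq_square field_simps)
  finally have "\<bar>?E\<bar> * (p + q) \<le> ((M2 - m2) * (p * q) / 8) * (p + q)"
    unfolding E .
  then have "\<bar>?E\<bar> \<le> (M2 - m2) * (p * q) / 8"
    using pq(3) by (rule mult_right_le_imp_le)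
  also have "\<dots> \<le> (M2 - m2) * ((p + q)\<^sup>2 / 4) / 8"
  proof -
    have "p * q \<le> (p + q)\<^sup>2 / 4"
      using zero_le_power2[of "p - q"] by (simp add: power2_eq_square field_simps)
    moreover have "0 \<le> M2 - m2" using lower[OF x] upper[OF x] by simp
    ultimately show ?thesis by (intro divide_right_mono mult_left_mono) auto
  qed
  finally show "\<bar>?E\<bar> \<le> (b - a)^2 / 32 * (M2 - m2)"
    by (simp add: pq(4) mult.commute)
qed

end
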